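(* Let $\sigma:\mathcal{E}\to\mathbb{R}$ be a sublinear function. Then, for $\lambda\in\mathbb{R}$, $\sigma$ is $\lambda$-smoothable if and only if $\lambda\ge w_\sigma/2$. In particular, for any target smoothness level $\beta>0$, a $\beta$-smooth convex function $f:\mathcal{E}\to\mathbb{R}$ is an optimal $\beta$-smoothing of $\sigma$ if and only if $[F^{\mathrm{gen}}_\sigma]_{1/\beta}\le f\le [f^{\mathrm{gen}}_\sigma]_{1/\beta}$ pointwise on $\mathcal{E}$.
   Context: $\mathcal{E}$ is a finite-dimensional Euclidean space with inner product $\langle\cdot,\cdot\rangle$ and induced norm $\|\cdot\|$. A function $\sigma:\mathcal{E}\to\mathbb{R}$ is sublinear if $\sigma(tx)=t\sigma(x)$ for all $t\ge 0$ and $\sigma(x+y)\le\sigma(x)+\sigma(y)$. A function $f:\mathcal{E}\to\mathbb{R}$ is $\beta$-smooth if it is differentiable with $\|\nabla f(x)-\nabla f(y)\|\le\beta\|x-y\|$ for all $x,y$. For $f,g:\mathcal{E}\to\mathbb{R}$, $\mathrm{dist}(f,g)=\sup_{x}|f(x)-g(x)|$ (possibly $+\infty$). For $\eta>0$, $[f]_\eta(x)=\eta f(x/\eta)$. The infimal convolution is $(f\,\square\,g)(x)=\inf_{y}f(y)+g(x-y)$. The epigraph is $\mathrm{epi}\,f=\{(x,\alpha)\in\mathcal{E}\times\mathbb{R}: f(x)\le\alpha\}$, and $\partial\sigma(0)$ is the convex subdifferential of $\sigma$ at $0$. Smoothability: $\sigma$ is $\lambda$-smoothable if for every $\beta>0$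 there is a $\beta$-smooth convex $f:\mathcal{E}\to\mathbb{R}$ with $\mathrm{dist}(f,\sigma)\le\lambda/\beta$. A convex $f:\mathcal{E}\to\mathbb{R}$ is an optimal $\beta$-smoothing of $\sigma$ if $f$ is $\beta$-smooth and $\mathrm{dist}(\sigma,f)\le\mathrm{dist}(\sigma,\tilde f)$ for all $\beta$-smooth convex $\tilde f:\mathcal{E}\to\mathbb{R}$. Core, center, width: $C_\sigma=\{(x,r)\in\mathcal{E}\times\mathbb{R}: (x,r)+\mathrm{epi}\,\tfrac12\|\cdot\|^2\subseteq\mathrm{epi}\,\sigma\}$; $(x_\sigma,r_\sigma)$ is the (unique) minimizer of $r+\tfrac12\|x\|^2$ over $(x,r)\in C_\sigma$; $w_\sigma=r_\sigma+\tfrac12\|x_\sigma\|^2$; and $\varrho_\sigma(x)=\max_{\zeta\in\partial\sigma(0)}\langle\zeta,x\rangle+\tfrac12\|\zeta\|^2$. Extremal smoothings: $f^{\mathrm{gen}}_\sigma=\big[(r_\sigma+\sigma(\cdot-x_\sigma))\,\square\,\tfrac12\|\cdot\|^2\big]-w_\sigma/2$ and $F^{\mathrm{gen}}_\sigma=\big[\varrho_\sigma\,\square\,\tfrac12\|\cdot\|^2\big]-w_\sigma/2$. *)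

theory Defs
  imports "HOL-Analysis.Analysis"
begin

definition sublinear :: "('a::real_vector \<Rightarrow> real) \<Rightarrow> bool" where
  "sublinear \<sigma> \<longleftrightarrow>
     (\<forall>t x. 0 \<le> t \<longrightarrow> \<sigma> (t *\<^sub>R x) = t * \<sigma> x) \<and> (\<forall>x y. \<sigma> (x + y) \<le> \<sigma> x + \<sigma> y)"

definition smooth_fun :: "real \<Rightarrow> ('a::euclidean_space \<Rightarrow> real) \<Rightarrow> bool" where
  "smooth_fun \<beta> f \<longleftrightarrow>
     (\<exists>g. (\<forall>x. GDERIV f x :> g x) \<and> (\<forall>x y. norm (g x - g y) \<le> \<beta> * norm (x - y)))"

text \<open>Extended-real valued, since the supremum may be infinite.\<close>

definition fun_dist :: "('a \<Rightarrow> real) \<Rightarrow> ('a \<Rightarrow> real) \<Rightarrow> ereal" where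
  "fun_dist f g = (SUP x. ereal \<bar>f x - g x\<bar>)"

definition rescale :: "real \<Rightarrow> ('a::real_vector \<Rightarrow> real) \<Rightarrow> 'a \<Rightarrow> real" where
  "rescale \<eta> f x = \<eta> * f (x /\<^sub>R \<eta>)"

text \<open>A real infimum: it is the true infimal convolution only if the infimand is bounded below
  for each \<open>x\<close>. This holds below, where \<open>f\<close> is a finite convex function and \<open>g\<close> is
  \<open>\<lambda>y. (norm y)\<^sup>2 / 2\<close>.\<close>

definition inf_conv :: "('a::ab_group_add \<Rightarrow> real) \<Rightarrow> ('a \<Rightarrow> real) \<Rightarrow> 'a \<Rightarrow> real" where
  "inf_conv f g x = (INF y. f y + g (x - y))"

definition subdifferential :: "('a::real_inner \<Rightarrow> real) \<Rightarrow> 'a \<Rightarrow> 'a set" where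
  "subdifferential f x = {\<zeta>. \<forall>y. f x + \<zeta> \<bullet> (y - x) \<le> f y}"

definition half_sq_norm :: "'a::real_normed_vector \<Rightarrow> real" where
  "half_sq_norm x = (norm x)\<^sup>2 / 2"

definition smoothable :: "real \<Rightarrow> ('a::euclidean_space \<Rightarrow> real) \<Rightarrow> bool" where
  "smoothable l \<sigma> \<longleftrightarrow>
     (\<forall>\<beta>>0. \<exists>f. convex_on UNIV f \<and> smooth_fun \<beta> f \<and> fun_dist f \<sigma> \<le> ereal (l / \<beta>))"

definition optimal_smoothing ::
    "real \<Rightarrow> ('a::euclidean_space \<Rightarrow> real) \<Rightarrow> ('a \<Rightarrow> real) \<Rightarrow> bool" where
  "optimal_smoothing \<beta> \<sigma> f \<longleftrightarrow>
     convex_on UNIV f \<and> smooth_fun \<beta> f \<and>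
     (\<forall>h. convex_on UNIV h \<and> smooth_fun \<beta> h \<longrightarrow> fun_dist \<sigma> f \<le> fun_dist \<sigma> h)"

definition smoothing_core :: "('a::euclidean_space \<Rightarrow> real) \<Rightarrow> ('a \<times> real) set" where
  "smoothing_core \<sigma> =
     {(x, r). (\<lambda>p. (x, r) + p) ` epigraph UNIV half_sq_norm \<subseteq> epigraph UNIV \<sigma>}"

definition core_objective :: "'a::euclidean_space \<times> real \<Rightarrow> real" where
  "core_objective p = snd p + half_sq_norm (fst p)"

text \<open>For sublinear \<open>\<sigma>\<close> the minimizer over the core exists and is unique, so the
  definite description is proper.\<close>

definition core_center :: "('a::euclidean_space \<Rightarrow> real) \<Rightarrow> 'a \<times> real" where
  "core_center \<sigma> = (THE p. is_arg_min core_objective (\<lambda>q. q \<in> smoothing_core \<sigma>) p)"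

definition x_center :: "('a::euclidean_space \<Rightarrow> real) \<Rightarrow> 'a" where
  "x_center \<sigma> = fst (core_center \<sigma>)"

definition r_center :: "('a::euclidean_space \<Rightarrow> real) \<Rightarrow> real" where
  "r_center \<sigma> = snd (core_center \<sigma>)"

definition width :: "('a::euclidean_space \<Rightarrow> real) \<Rightarrow> real" where
  "width \<sigma> = r_center \<sigma> + half_sq_norm (x_center \<sigma>)"

text \<open>For sublinear \<open>\<sigma>\<close> the subdifferential at \<open>0\<close> is nonempty and compact,
  so the supremum is a maximum.\<close>

definition varrho :: "('a::euclidean_space \<Rightarrow> real) \<Rightarrow> 'a \<Rightarrow> real" where
  "varrho \<sigma> x = (SUP \<zeta>\<in>subdifferential \<sigma> 0. \<zeta> \<bullet> x + half_sq_norm \<zeta>)"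

definition f_gen :: "('a::euclidean_space \<Rightarrow> real) \<Rightarrow> 'a \<Rightarrow> real" where
  "f_gen \<sigma> x =
     inf_conv (\<lambda>y. r_center \<sigma> + \<sigma> (y - x_center \<sigma>)) half_sq_norm x - width \<sigma> / 2"

definition F_gen :: "('a::euclidean_space \<Rightarrow> real) \<Rightarrow> 'a \<Rightarrow> real" where
  "F_gen \<sigma> x = inf_conv (varrho \<sigma>) half_sq_norm x - width \<sigma> / 2"

end

theory Submission
  imports Defs
begin

text \<open>
  A positively homogeneous \<open>\<sigma>\<close> equals its own rescaling, so rescaling by \<open>\<beta>\<close> reduces every
  smoothness level \<open>\<beta>\<close> to \<open>1\<close> and multiplies distances to \<open>\<sigma>\<close> by \<open>\<beta>\<close>. Let \<open>K\<close> be the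
  subdifferential of \<open>\<sigma>\<close> at \<open>0\<close>, whose support function is \<open>\<sigma>\<close>. Completing squares shows that
  the core is the epigraph of \<open>varrho \<sigma>\<close> (\<open>varrho_le_iff_core\<close>); its center is minus the
  circumcenter of \<open>K\<close>, and the width is half the squared circumradius. Write \<open>w\<close> for the width
  and \<open>c\<close> for \<open>x_center \<sigma>\<close>.

  Suppose that \<open>f\<close> is \<open>1\<close>-smooth with gradient \<open>g\<close> and within \<open>d\<close> of \<open>\<sigma>\<close>. At each point \<open>z\<close>,
  the graph of \<open>f\<close> lies below a paraboloid of curvature \<open>1\<close>, and \<open>\<sigma>\<close> lies below that paraboloid
  raised by \<open>d\<close>. The raised paraboloid is a translate of \<open>|x|\<^sup>2 / 2\<close>, so its vertex is a point of
  the core (\<open>core_point_of_smooth_fun\<close>). For \<open>z = 0\<close> the objective at this core point is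
  \<open>d + f 0 \<le> 2 d\<close>, hence \<open>w \<le> 2 d\<close>: no smoothing is closer than \<open>w / 2\<close>.

  If \<open>d = w / 2\<close>, then for \<open>z = 0\<close> the core point is the center by uniqueness, which fixes
  \<open>g 0 = - c\<close>. For general \<open>z\<close>, the core point bounds \<open>varrho \<sigma>\<close> at \<open>z - g z\<close> and yields
  \<open>F_gen \<sigma> z \<le> f z\<close>. In the other direction, the value and the gradient of \<open>f\<close> at \<open>0\<close> control
  \<open>f z\<close> through the strengthened subgradient inequality (\<open>smooth_convex_lower_bound\<close>), and
  \<open>g z\<close> lies in \<open>K\<close> because \<open>f\<close> stays near \<open>\<sigma>\<close>; together these give \<open>f z \<le> f_gen \<sigma> z\<close>.
  Conversely \<open>\<sigma> - w / 2 \<le> F_gen \<sigma>\<close> and \<open>f_gen \<sigma> \<le> \<sigma> + w / 2\<close> follow by testing the infimal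
  convolutions, so everything between the two functions is within \<open>w / 2\<close> of \<open>\<sigma>\<close>.

  The bound \<open>w / 2\<close> is attained by \<open>f_gen \<sigma>\<close> itself. Up to constants it is the Moreau envelope
  of a support function, translated by \<open>c\<close>, and its gradient is \<open>x \<mapsto> closest_point K (x - c)\<close>,
  which is nonexpansive (\<open>f_gen_smooth_convex\<close>).
\<close>

section \<open>Convex functions and their gradients\<close>

text \<open>The point \<open>(u, f u)\<close> is separated from the strict epigraph by a hyperplane. It is not
  vertical because the strict epigraph projects onto the whole space; normalizing its vertical
  coefficient makes it the graph of a supporting affine function.\<close>

lemma convex_imp_subgradient:
  fixes f :: "'a::euclidean_space \<Rightarrow> real"
  assumes "convex_on UNIV f"
  obtains z where "z \<in> subdifferential f u"
proof -
  let ?S = "{p. f (fst p) < snd p}"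
  have "convex ?S"
    unfolding convex_def
  proof (intro ballI allI impI)
    fix p q :: "'a \<times> real" and s t :: real
    assume pq: "p \<in> ?S" "q \<in> ?S" and st: "0 \<le> s" "0 \<le> t" "s + t = 1"
    have "f (s *\<^sub>R fst p + t *\<^sub>R fst q) \<le> s * f (fst p) + t * f (fst q)"
      using assms st by (auto simp: convex_on_def)
    also have "\<dots> < s * snd p + t * snd q"
    proof (cases "s = 0")
      case True
      then show ?thesis using pq st by simp
    next
      case False
      then have "s * f (fst p) < s * snd p" "t * f (fst q) \<le> t * snd q"
        using pq st by (auto intro: mult_left_mono)
      then show ?thesis by linarith
    qed
    finally show "s *\<^sub>R p + t *\<^sub>R q \<in> ?S" by simp
  qed
  moreover have "?S \<noteq> {}"
  proof -
    have "(u, f u + 1) \<in> ?S" by simp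
    then show ?thesis by blast
  qed
  moreover have "{(u, f u)} \<inter> ?S = {}" by auto
  ultimately have "\<exists>n c. n \<noteq> 0 \<and> (\<forall>p\<in>{(u, f u)}. n \<bullet> p \<le> c) \<and> (\<forall>p\<in>?S. c \<le> n \<bullet> p)"
    by (intro separating_hyperplane_sets) simp_all
  then obtain n c where n: "n \<noteq> 0" "n \<bullet> (u, f u) \<le> c" "\<forall>p\<in>?S. c \<le> n \<bullet> p"
    by blast
  obtain a b where ab: "n = (a, b)" by (cases n)
  have sep: "a \<bullet> u + b * f u \<le> a \<bullet> y + b * t" if "f y < t" for y t
  proof -
    have "c \<le> n \<bullet> (y, t)" using n(3) that by auto
    with n(2) ab show ?thesis by simp
  qed
  have "0 \<le> b" using sep[of u "f u + 1"] by (simp add: algebra_simps)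
  moreover have "b \<noteq> 0"
  proof
    assume b: "b = 0"
    have "a \<bullet> a \<le> 0"
      using sep[of "u - a" "f (u - a) + 1"] b by (simp add: algebra_simps)
    then have "a = 0" by (metis inner_eq_zero_iff inner_ge_zero order_antisym)
    with n(1) ab b show False by (simp add: zero_prod_def)
  qed
  ultimately have b: "0 < b" by simp
  have "f u + (- a /\<^sub>R b) \<bullet> (y - u) \<le> f y" for y
  proof (rule dense_ge)
    fix t assume "f y < t"
    from sep[OF this] have "a \<bullet> u - a \<bullet> y \<le> (t - f u) * b" by (simp add: algebra_simps)
    then have "(a \<bullet> u - a \<bullet> y) / b \<le> t - f u" using b by (simp add: pos_divide_le_eq)
    then show "f u + (- a /\<^sub>R b) \<bullet> (y - u) \<le> t"
      using b by (simp add: inner_diff_right divide_inverse algebra_simps)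
  qed
  then have "- a /\<^sub>R b \<in> subdifferential f u" unfolding subdifferential_def by blast
  then show ?thesis by (rule that)
qed

lemma convex_on_if_subgradients:
  fixes f :: "'a::euclidean_space \<Rightarrow> real"
  assumes "\<And>x. g x \<in> subdifferential f x"
  shows "convex_on UNIV f"
proof (rule convex_onI)
  fix t :: real and x y :: 'a
  assume t: "0 < t" "t < 1"
  let ?z = "(1 - t) *\<^sub>R x + t *\<^sub>R y"
  have sub: "f ?z + g ?z \<bullet> (w - ?z) \<le> f w" for w
    using assms by (auto simp: subdifferential_def)
  have "(1 - t) * (f ?z + g ?z \<bullet> (x - ?z)) + t * (f ?z + g ?z \<bullet> (y - ?z))
      \<le> (1 - t) * f x + t * f y"
    using t sub by (intro add_mono mult_left_mono) auto
  moreover have "(1 - t) * (f ?z + g ?z \<bullet> (x - ?z)) + t * (f ?z + g ?z \<bullet> (y - ?z)) = f ?z"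
    by (simp add: inner_diff_right inner_add_right algebra_simps)
  ultimately show "f ?z \<le> (1 - t) * f x + t * f y" by simp
qed simp

lemma GDERIV_along_line:
  assumes "\<And>x. GDERIV f x :> g x"
  shows "((\<lambda>t. f (z + t *\<^sub>R d)) has_field_derivative g (z + t *\<^sub>R d) \<bullet> d) (at t)"
proof -
  have "((\<lambda>t. z + t *\<^sub>R d) has_derivative (\<lambda>h. h *\<^sub>R d)) (at t)"
    by (auto intro!: derivative_eq_intros)
  moreover have "(f has_derivative (\<lambda>h. h \<bullet> g (z + t *\<^sub>R d))) (at (z + t *\<^sub>R d))"
    using assms by (simp add: gderiv_def)
  ultimately have "((\<lambda>t. f (z + t *\<^sub>R d)) has_derivative (\<lambda>h. (h *\<^sub>R d) \<bullet> g (z + t *\<^sub>R d))) (at t)"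
    by (rule has_derivative_compose)
  then show ?thesis
    by (simp add: has_field_derivative_def inner_commute mult_commute_abs)
qed

lemma gradient_in_subdifferential:
  fixes f :: "'a::euclidean_space \<Rightarrow> real"
  assumes "convex_on UNIV f" and grad: "\<And>x. GDERIV f x :> g x"
  shows "g z \<in> subdifferential f z"
  unfolding subdifferential_def mem_Collect_eq
proof
  fix y
  let ?\<phi> = "\<lambda>t. f (z + t *\<^sub>R (y - z))"
  have "convex_on UNIV ?\<phi>"
  proof (rule convex_onI)
    fix t a b :: real
    assume t: "0 < t" "t < 1"
    have "z + ((1 - t) *\<^sub>R a + t *\<^sub>R b) *\<^sub>R (y - z)
        = (1 - t) *\<^sub>R (z + a *\<^sub>R (y - z)) + t *\<^sub>R (z + b *\<^sub>R (y - z))"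
      by (simp add: algebra_simps)
    then show "?\<phi> ((1 - t) *\<^sub>R a + t *\<^sub>R b) \<le> (1 - t) * ?\<phi> a + t * ?\<phi> b"
      using convex_onD[OF assms(1), of t] t by simp
  qed simp
  then have "g z \<bullet> (y - z) * (1 - 0) \<le> ?\<phi> 1 - ?\<phi> 0"
    using GDERIV_along_line[OF grad, of z "y - z" 0]
    by (intro convex_on_imp_above_tangent[of UNIV]) auto
  then show "f z + g z \<bullet> (y - z) \<le> f y" by simp
qed

text \<open>Along the segment from \<open>z\<close> to \<open>y\<close>, the difference of the two sides has
  derivative \<open>(g (z + t d) - g z) \<bullet> d - L t |d|\<^sup>2\<close> with \<open>d = y - z\<close>, which the Lipschitz
  bound makes nonpositive.\<close>

lemma descent_lemma:
  fixes f :: "'a::euclidean_space \<Rightarrow> real"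
  assumes grad: "\<And>x. GDERIV f x :> g x"
    and lip: "\<And>x y. norm (g x - g y) \<le> L * norm (x - y)"
  shows "f y \<le> f z + g z \<bullet> (y - z) + L * half_sq_norm (y - z)"
proof -
  define d where "d = y - z"
  let ?\<phi> = "\<lambda>t. f (z + t *\<^sub>R d) - t * (g z \<bullet> d) - L * half_sq_norm d * t\<^sup>2"
  have "?\<phi> 1 \<le> ?\<phi> 0"
  proof (rule DERIV_nonpos_imp_nonincreasing[where f = ?\<phi>])
    fix t :: real assume t: "0 \<le> t" "t \<le> 1"
    let ?D = "g (z + t *\<^sub>R d) \<bullet> d - g z \<bullet> d - L * half_sq_norm d * (2 * t)"
    have "(?\<phi> has_field_derivative ?D) (at t)"
      by (auto intro!: derivative_eq_intros GDERIV_along_line[OF grad])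
    moreover have "?D \<le> 0"
    proof -
      have "(g (z + t *\<^sub>R d) - g z) \<bullet> d \<le> norm (g (z + t *\<^sub>R d) - g z) * norm d"
        by (rule norm_cauchy_schwarz)
      also have "\<dots> \<le> (L * norm (t *\<^sub>R d)) * norm d"
        using lip[of "z + t *\<^sub>R d" z] by (intro mult_right_mono) auto
      also have "\<dots> = L * half_sq_norm d * (2 * t)"
        using t by (simp add: half_sq_norm_def power2_eq_square)
      finally show ?thesis by (simp add: inner_diff_left)
    qed
    ultimately show "\<exists>D. (?\<phi> has_real_derivative D) (at t) \<and> D \<le> 0" by blast
  qed simp
  then show ?thesis by (simp add: d_def)
qed

text \<open>The tangent plane at \<open>z\<close> lies below \<open>f\<close> and the paraboloid of curvature \<open>L\<close> at \<open>x\<close>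
  lies above it. Comparing the two at the point \<open>x - (g x - g z) / L\<close>, where the paraboloid exceeds
  the plane by the least amount, gives the quadratic gain over the subgradient inequality.\<close>

lemma smooth_convex_lower_bound:
  fixes f :: "'a::euclidean_space \<Rightarrow> real"
  assumes conv: "convex_on UNIV f" and grad: "\<And>x. GDERIV f x :> g x"
    and lip: "\<And>x y. norm (g x - g y) \<le> L * norm (x - y)" and L: "0 < L"
  shows "f z + g z \<bullet> (x - z) + half_sq_norm (g z - g x) / L \<le> f x"
proof -
  define d where "d = g x - g z"
  define y where "y = x - d /\<^sub>R L"
  have "f z + g z \<bullet> (y - z) \<le> f y"
    using gradient_in_subdifferential[OF conv grad] by (auto simp: subdifferential_def)
  also have "f y \<le> f x + g x \<bullet> (y - x) + L * half_sq_norm (y - x)"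
    by (rule descent_lemma[OF grad lip])
  finally have "f z + g z \<bullet> (x - z) + (g x - g z) \<bullet> (x - y) - L * half_sq_norm (y - x) \<le> f x"
    by (simp add: inner_diff_left inner_diff_right)
  moreover have "(g x - g z) \<bullet> (x - y) = 2 * half_sq_norm d / L"
  proof -
    have "(g x - g z) \<bullet> (x - y) = d \<bullet> (d /\<^sub>R L)" by (simp add: y_def d_def)
    also have "\<dots> = 2 * half_sq_norm d / L"
      using L by (simp add: half_sq_norm_def power2_norm_eq_inner field_simps)
    finally show ?thesis .
  qed
  moreover have "L * half_sq_norm (y - x) = half_sq_norm d / L"
    using L by (simp add: y_def half_sq_norm_def power_divide power2_eq_square field_simps)
  moreover have "half_sq_norm (g z - g x) = half_sq_norm d"
    by (simp add: d_def half_sq_norm_def norm_minus_commute)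
  ultimately show ?thesis by simp
qed

text \<open>This form suits functions defined as infima, where an explicit minorant and an explicit
  competitor are at hand but the function itself cannot be differentiated directly.\<close>

lemma GDERIV_if_quadratic_sandwich:
  fixes f :: "'a::euclidean_space \<Rightarrow> real"
  assumes lower: "\<And>y. f x + p \<bullet> (y - x) \<le> f y"
    and upper: "\<And>y. f y \<le> f x + p \<bullet> (y - x) + L * half_sq_norm (y - x)"
  shows "GDERIV f x :> p"
  unfolding gderiv_def has_derivative_at
proof
  show "bounded_linear (\<lambda>h. h \<bullet> p)" by (rule bounded_linear_inner_left)
  show "(\<lambda>h. norm (f (x + h) - f x - h \<bullet> p) / norm h) \<midarrow>0\<rightarrow> 0"
  proof (rule tendsto_sandwich[where f = "\<lambda>_. 0" and h = "\<lambda>h. L / 2 * norm h"])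
    show "\<forall>\<^sub>F h in at 0. norm (f (x + h) - f x - h \<bullet> p) / norm h \<le> L / 2 * norm h"
    proof (rule eventually_mono[OF eventually_neq_at_within])
      fix h :: 'a assume "h \<noteq> 0"
      have "norm (f (x + h) - f x - h \<bullet> p) \<le> L * half_sq_norm h"
        using lower[of "x + h"] upper[of "x + h"] by (simp add: inner_commute)
      with \<open>h \<noteq> 0\<close> show "norm (f (x + h) - f x - h \<bullet> p) / norm h \<le> L / 2 * norm h"
        by (simp add: half_sq_norm_def field_simps power2_eq_square)
    qed
    have "(\<lambda>h::'a. L / 2 * norm h) \<midarrow>0\<rightarrow> L / 2 * norm (0::'a)"
      by (intro tendsto_intros)
    then show "(\<lambda>h::'a. L / 2 * norm h) \<midarrow>0\<rightarrow> 0" by simp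
  qed auto
qed

section \<open>Rescaling\<close>

lemma rescale_rescale_inverse:
  "\<eta> \<noteq> 0 \<Longrightarrow> rescale (1 / \<eta>) (rescale \<eta> f) = f"
  by (simp add: rescale_def fun_eq_iff)

lemma rescale_mono:
  assumes "0 < \<eta>" "\<And>x. f x \<le> h x"
  shows "rescale \<eta> f x \<le> rescale \<eta> h x"
  using assms by (simp add: rescale_def)

lemma convex_on_rescale:
  assumes "convex_on UNIV f" "0 < \<eta>"
  shows "convex_on UNIV (rescale \<eta> f)"
proof (rule convex_onI)
  fix t :: real and x y :: 'a
  assume "0 < t" "t < 1"
  then have "f ((1 - t) *\<^sub>R (x /\<^sub>R \<eta>) + t *\<^sub>R (y /\<^sub>R \<eta>)) \<le> (1 - t) * f (x /\<^sub>R \<eta>) + t * f (y /\<^sub>R \<eta>)"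
    using convex_onD[OF assms(1), of t "x /\<^sub>R \<eta>" "y /\<^sub>R \<eta>"] by simp
  then have "\<eta> * f ((1 - t) *\<^sub>R (x /\<^sub>R \<eta>) + t *\<^sub>R (y /\<^sub>R \<eta>))
      \<le> \<eta> * ((1 - t) * f (x /\<^sub>R \<eta>) + t * f (y /\<^sub>R \<eta>))"
    using assms(2) by simp
  then show "rescale \<eta> f ((1 - t) *\<^sub>R x + t *\<^sub>R y) \<le> (1 - t) * rescale \<eta> f x + t * rescale \<eta> f y"
    by (simp add: rescale_def algebra_simps)
qed simp

lemma smooth_fun_rescale:
  assumes "smooth_fun \<beta> f" "0 < \<eta>"
  shows "smooth_fun (\<beta> / \<eta>) (rescale \<eta> f)"
proof -
  obtain g where grad: "\<And>x. GDERIV f x :> g x"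
    and lip: "\<And>x y. norm (g x - g y) \<le> \<beta> * norm (x - y)"
    using assms(1) by (auto simp: smooth_fun_def)
  have "GDERIV (rescale \<eta> f) x :> g (x /\<^sub>R \<eta>)" for x
  proof -
    have "((\<lambda>x. x /\<^sub>R \<eta>) has_derivative (\<lambda>h. h /\<^sub>R \<eta>)) (at x)"
      by (auto intro!: derivative_eq_intros)
    moreover have "(f has_derivative (\<lambda>h. h \<bullet> g (x /\<^sub>R \<eta>))) (at (x /\<^sub>R \<eta>))"
      using grad by (simp add: gderiv_def)
    ultimately have "((\<lambda>x. f (x /\<^sub>R \<eta>)) has_derivative (\<lambda>h. (h /\<^sub>R \<eta>) \<bullet> g (x /\<^sub>R \<eta>))) (at x)"
      by (rule has_derivative_compose)
    then have "((\<lambda>x. \<eta> * f (x /\<^sub>R \<eta>)) has_derivative (\<lambda>h. \<eta> * ((h /\<^sub>R \<eta>) \<bullet> g (x /\<^sub>R \<eta>)))) (at x)"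
      by (rule has_derivative_mult_right)
    moreover have "\<eta> * ((h /\<^sub>R \<eta>) \<bullet> g (x /\<^sub>R \<eta>)) = h \<bullet> g (x /\<^sub>R \<eta>)" for h
      using assms(2) by simp
    ultimately show ?thesis by (simp only: gderiv_def rescale_def[abs_def])
  qed
  moreover have "norm (g (x /\<^sub>R \<eta>) - g (y /\<^sub>R \<eta>)) \<le> \<beta> / \<eta> * norm (x - y)" for x y
    using lip[of "x /\<^sub>R \<eta>" "y /\<^sub>R \<eta>"] assms(2)
    by (simp add: scaleR_diff_right[symmetric] divide_inverse mult.assoc)
  ultimately show ?thesis
    unfolding smooth_fun_def by (intro exI[of _ "\<lambda>x. g (x /\<^sub>R \<eta>)"]) auto
qed

lemma fun_dist_le_iff: "fun_dist f h \<le> ereal d \<longleftrightarrow> (\<forall>x. \<bar>f x - h x\<bar> \<le> d)"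
  by (simp add: fun_dist_def SUP_le_iff)

lemma fun_dist_le_iff_two_sided:
  "fun_dist f h \<le> ereal d \<longleftrightarrow> (\<forall>x. h x \<le> f x + d) \<and> (\<forall>x. f x \<le> h x + d)"
proof -
  have "\<bar>f x - h x\<bar> \<le> d \<longleftrightarrow> h x \<le> f x + d \<and> f x \<le> h x + d" for x by linarith
  then show ?thesis by (simp add: fun_dist_le_iff all_conj_distrib)
qed

lemma fun_dist_commute: "fun_dist f h = fun_dist h f"
  by (simp add: fun_dist_def abs_minus_commute)

text \<open>Rescaling multiplies the distance to \<open>\<sigma>\<close> by \<open>\<eta>\<close> because a positively homogeneous
  function is its own rescaling.\<close>

lemma rescale_sublinear:
  assumes "sublinear \<sigma>" "0 < \<eta>"
  shows "rescale \<eta> \<sigma> = \<sigma>"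
proof
  fix x
  have "\<sigma> (\<eta> *\<^sub>R (x /\<^sub>R \<eta>)) = \<eta> * \<sigma> (x /\<^sub>R \<eta>)"
    using assms unfolding sublinear_def by (metis less_imp_le)
  then show "rescale \<eta> \<sigma> x = \<sigma> x" using assms(2) by (simp add: rescale_def)
qed

lemma fun_dist_rescale_le:
  assumes "sublinear \<sigma>" "0 < \<eta>" "fun_dist f \<sigma> \<le> ereal d"
  shows "fun_dist (rescale \<eta> f) \<sigma> \<le> ereal (\<eta> * d)"
proof -
  have "\<bar>rescale \<eta> f x - rescale \<eta> \<sigma> x\<bar> \<le> \<eta> * d" for x
    using assms(2,3) unfolding fun_dist_le_iff rescale_def
    by (simp add: right_diff_distrib[symmetric] abs_mult)
  then show ?thesis using rescale_sublinear[OF assms(1,2)] by (simp add: fun_dist_le_iff)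
qed

section \<open>Sublinear functions as support functions\<close>

lemma sublinear_scale: "sublinear \<sigma> \<Longrightarrow> 0 \<le> t \<Longrightarrow> \<sigma> (t *\<^sub>R x) = t * \<sigma> x"
  by (simp add: sublinear_def)

lemma sublinear_add: "sublinear \<sigma> \<Longrightarrow> \<sigma> (x + y) \<le> \<sigma> x + \<sigma> y"
  by (simp add: sublinear_def)

lemma sublinear_zero: "sublinear \<sigma> \<Longrightarrow> \<sigma> 0 = 0"
  using sublinear_scale[of \<sigma> 0 0] by simp

lemma sublinear_convex:
  assumes "sublinear \<sigma>"
  shows "convex_on UNIV \<sigma>"
proof (rule convex_onI)
  fix t :: real and x y :: 'a
  assume "0 < t" "t < 1"
  then show "\<sigma> ((1 - t) *\<^sub>R x + t *\<^sub>R y) \<le> (1 - t) * \<sigma> x + t * \<sigma> y"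
    using sublinear_add[OF assms, of "(1 - t) *\<^sub>R x" "t *\<^sub>R y"] by (simp add: sublinear_scale[OF assms])
qed simp

lemma sublinear_bounded:
  fixes \<sigma> :: "'a::euclidean_space \<Rightarrow> real"
  assumes "sublinear \<sigma>"
  obtains L where "\<And>x. \<bar>\<sigma> x\<bar> \<le> L * norm x"
proof -
  have "continuous_on UNIV \<sigma>"
    using sublinear_convex[OF assms] by (rule convex_on_continuous[OF open_UNIV])
  then have "continuous_on (cball 0 1) \<sigma>" by (rule continuous_on_subset) simp
  then have "bounded (\<sigma> ` cball 0 1)"
    by (intro compact_imp_bounded compact_continuous_image) auto
  then obtain L where L: "\<And>x. norm x \<le> 1 \<Longrightarrow> \<bar>\<sigma> x\<bar> \<le> L"
    by (force simp: bounded_iff)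
  have "\<bar>\<sigma> x\<bar> \<le> L * norm x" for x
  proof (cases "x = 0")
    case False
    have "\<sigma> x = norm x * \<sigma> (x /\<^sub>R norm x)"
      using False sublinear_scale[OF assms, of "norm x" "x /\<^sub>R norm x"] by simp
    moreover have "\<bar>\<sigma> (x /\<^sub>R norm x)\<bar> \<le> L" using False by (intro L) simp
    ultimately show ?thesis by (metis abs_mult abs_norm_cancel mult.commute mult_left_mono norm_ge_zero)
  qed (simp add: sublinear_zero[OF assms])
  then show ?thesis by (rule that)
qed

lemma mem_subdifferential_sublinear:
  "sublinear \<sigma> \<Longrightarrow> \<zeta> \<in> subdifferential \<sigma> 0 \<longleftrightarrow> (\<forall>y. \<zeta> \<bullet> y \<le> \<sigma> y)"
  by (simp add: subdifferential_def sublinear_zero)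

lemma closed_convex_subdifferential:
  "closed (subdifferential f x)" "convex (subdifferential f x)"
proof -
  have eq: "subdifferential f x = (\<Inter>y. {\<zeta>. (y - x) \<bullet> \<zeta> \<le> f y - f x})"
    by (auto simp: subdifferential_def inner_commute le_diff_eq add.commute)
  show "closed (subdifferential f x)" "convex (subdifferential f x)"
    unfolding eq by (auto intro!: closed_INT closed_halfspace_le convex_INT convex_halfspace_le)
qed

text \<open>A subgradient at \<open>u\<close> is by homogeneity one at \<open>0\<close> too, and it attains \<open>\<sigma> u\<close>.\<close>

lemma sublinear_support:
  fixes \<sigma> :: "'a::euclidean_space \<Rightarrow> real"
  assumes "sublinear \<sigma>"
  obtains \<zeta> where "\<zeta> \<in> subdifferential \<sigma> 0" "\<zeta> \<bullet> u = \<sigma> u"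
proof -
  obtain \<zeta> where "\<zeta> \<in> subdifferential \<sigma> u"
    using convex_imp_subgradient[OF sublinear_convex[OF assms]] .
  then have sub: "\<sigma> u + \<zeta> \<bullet> (y - u) \<le> \<sigma> y" for y
    by (auto simp: subdifferential_def)
  have "\<zeta> \<bullet> u = \<sigma> u"
    using sub[of 0] sub[of "2 *\<^sub>R u"] assms
    by (simp add: sublinear_zero sublinear_scale inner_diff_right)
  moreover have "\<zeta> \<bullet> v \<le> \<sigma> v" for v
    using sub[of "u + v"] sublinear_add[OF assms, of u v] by simp
  ultimately show ?thesis
    using that mem_subdifferential_sublinear[OF assms] by blast
qed

lemma subdifferential_nonempty:
  fixes \<sigma> :: "'a::euclidean_space \<Rightarrow> real"
  assumes "sublinear \<sigma>"
  shows "subdifferential \<sigma> 0 \<noteq> {}"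
  by (rule sublinear_support[OF assms, of 0]) blast

text \<open>Along a ray the additive constants become negligible against the scaling factor, and
  homogeneity leaves only the comparison of the linear functional with \<open>\<sigma>\<close>.\<close>

lemma subgradient_of_function_near_sublinear:
  fixes \<sigma> :: "'a::euclidean_space \<Rightarrow> real"
  assumes sl: "sublinear \<sigma>" and \<zeta>: "\<zeta> \<in> subdifferential f z"
    and near: "\<And>y. f y \<le> \<sigma> y + d"
  shows "\<zeta> \<in> subdifferential \<sigma> 0"
  unfolding mem_subdifferential_sublinear[OF sl]
proof (rule allI, rule ccontr)
  fix y
  define \<epsilon> where "\<epsilon> = \<zeta> \<bullet> y - \<sigma> y"
  define C where "C = d - f z + \<zeta> \<bullet> z"
  assume "\<not> \<zeta> \<bullet> y \<le> \<sigma> y"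
  then have \<epsilon>: "0 < \<epsilon>" by (simp add: \<epsilon>_def)
  have "t * \<epsilon> \<le> C" if "0 \<le> t" for t
  proof -
    have "f z + \<zeta> \<bullet> (t *\<^sub>R y - z) \<le> \<sigma> (t *\<^sub>R y) + d"
      using \<zeta> near[of "t *\<^sub>R y"] unfolding subdifferential_def mem_Collect_eq by (meson order_trans)
    then show ?thesis
      using that by (simp add: C_def \<epsilon>_def sublinear_scale[OF sl] inner_diff_right algebra_simps)
  qed
  from this[of "(\<bar>C\<bar> + 1) / \<epsilon>"] \<epsilon> show False by simp
qed

section \<open>The core and its center\<close>

lemma half_sq_norm_eq_inner: "half_sq_norm x = x \<bullet> x / 2"
  by (simp add: half_sq_norm_def power2_norm_eq_inner)

lemma half_sq_norm_nonneg: "0 \<le> half_sq_norm x"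
  by (simp add: half_sq_norm_def)

lemma half_sq_norm_minus: "half_sq_norm (- x) = half_sq_norm x"
  by (simp add: half_sq_norm_def)

lemma inner_le_half_sq_norms: "x \<bullet> y \<le> half_sq_norm x + half_sq_norm y"
proof -
  have "0 \<le> (x - y) \<bullet> (x - y)" by simp
  then show ?thesis
    by (simp add: half_sq_norm_eq_inner inner_diff_left inner_diff_right inner_commute)
qed

lemma mem_core_iff:
  fixes x :: "'a::euclidean_space"
  shows "(x, r) \<in> smoothing_core \<sigma> \<longleftrightarrow> (\<forall>y. \<sigma> (x + y) \<le> r + half_sq_norm y)"
proof
  assume "(x, r) \<in> smoothing_core \<sigma>"
  moreover have "(y, half_sq_norm y) \<in> epigraph UNIV half_sq_norm" for y :: 'a
    by (simp add: mem_epigraph)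
  ultimately have "(x, r) + (y, half_sq_norm y) \<in> epigraph UNIV \<sigma>" for y
    by (auto simp only: smoothing_core_def mem_Collect_eq prod.case image_subset_iff)
  then show "\<forall>y. \<sigma> (x + y) \<le> r + half_sq_norm y" by (simp add: mem_epigraph)
next
  assume "\<forall>y. \<sigma> (x + y) \<le> r + half_sq_norm y"
  then have "\<sigma> (x + y) \<le> r + t" if "half_sq_norm y \<le> t" for y t
    using that by (smt (verit))
  then show "(x, r) \<in> smoothing_core \<sigma>"
    by (auto simp: smoothing_core_def mem_epigraph)
qed

text \<open>Linear growth of \<open>\<sigma>\<close> with constant \<open>L\<close> is dominated by \<open>L\<^sup>2 / 2 + |y|\<^sup>2 / 2\<close>.\<close>

lemma core_section_nonempty:
  fixes \<sigma> :: "'a::euclidean_space \<Rightarrow> real"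
  assumes "sublinear \<sigma>"
  obtains r where "(x, r) \<in> smoothing_core \<sigma>"
proof -
  obtain L where L: "\<And>x. \<bar>\<sigma> x\<bar> \<le> L * norm x" using sublinear_bounded[OF assms] by blast
  have "\<sigma> (x + y) \<le> \<sigma> x + L\<^sup>2 / 2 + half_sq_norm y" for y
  proof -
    have "0 \<le> (L - norm y)\<^sup>2" by simp
    then have "L * norm y \<le> L\<^sup>2 / 2 + half_sq_norm y"
      by (simp add: half_sq_norm_def power2_diff)
    then show ?thesis
      using sublinear_add[OF assms, of x y] L[of y] by linarith
  qed
  then show ?thesis using that mem_core_iff by blast
qed

lemma core_objective_simp: "core_objective (x, r) = r + half_sq_norm x"
  by (simp add: core_objective_def)

text \<open>The core lies above the graph of \<open>\<sigma>\<close>, so the objective at a core point is at least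
  \<open>|x|\<^sup>2 / 2 - L |x|\<close>, where \<open>L\<close> bounds the growth of \<open>\<sigma>\<close>. Its sublevel sets in the core are
  therefore compact.\<close>

lemma core_minimizer_exists:
  fixes \<sigma> :: "'a::euclidean_space \<Rightarrow> real"
  assumes sl: "sublinear \<sigma>"
  obtains p where "is_arg_min core_objective (\<lambda>q. q \<in> smoothing_core \<sigma>) p"
proof -
  obtain L where L: "\<And>x. \<bar>\<sigma> x\<bar> \<le> L * norm x" using sublinear_bounded[OF sl] by blast
  have cont: "continuous_on UNIV \<sigma>"
    using sublinear_convex[OF sl] by (rule convex_on_continuous[OF open_UNIV])
  obtain r0 where r0: "((0::'a), r0) \<in> smoothing_core \<sigma>" using core_section_nonempty[OF sl] .
  define S where "S = {p \<in> smoothing_core \<sigma>. core_objective p \<le> r0}"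
  have cont_obj: "continuous_on A core_objective" for A :: "('a \<times> real) set"
    unfolding core_objective_def[abs_def] half_sq_norm_def by (intro continuous_intros) auto
  have core_eq: "smoothing_core \<sigma> = (\<Inter>y. {p. \<sigma> (fst p + y) \<le> snd p + half_sq_norm y})"
    by (force simp: mem_core_iff)
  have "closed (smoothing_core \<sigma>)"
    unfolding core_eq
    by (intro closed_INT ballI closed_Collect_le continuous_intros
        continuous_on_compose2[OF cont]) auto
  moreover have "closed {p::'a \<times> real. core_objective p \<le> r0}"
    by (intro closed_Collect_le cont_obj continuous_intros)
  ultimately have "closed S" unfolding S_def by (simp add: closed_Collect_conj Collect_conj_eq closed_Int)
  moreover have "bounded S"
  proof -
    \<comment> \<open>For \<open>|x| \<ge> 1\<close>, the inequality \<open>|x|\<^sup>2 \<le> 2 |r0| + 2 |L| |x|\<close> for points of \<open>S\<close> can be divided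
      by \<open>|x|\<close>, giving \<open>|x| \<le> 2 |r0| + 2 |L|\<close>; the summand \<open>1\<close> covers \<open>|x| < 1\<close>.\<close>
    define B where "B = 2 * \<bar>L\<bar> + 2 * \<bar>r0\<bar> + 1"
    have "p \<in> cball 0 B \<times> {- B\<^sup>2..r0}" if "p \<in> S" for p
    proof -
      obtain x r where p: "p = (x, r)" by (cases p)
      have core: "\<And>y. \<sigma> (x + y) \<le> r + half_sq_norm y" and obj: "r + half_sq_norm x \<le> r0"
        using that by (auto simp: S_def p mem_core_iff core_objective_simp)
      have pos: "0 \<le> r + half_sq_norm x"
        using core[of "- x"] by (simp add: sublinear_zero[OF sl] half_sq_norm_minus)
      have "\<sigma> x \<le> r" using core[of 0] by (simp add: half_sq_norm_def)
      then have "half_sq_norm x \<le> r0 + \<bar>L\<bar> * norm x"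
        using obj L[of x] abs_ge_self[of L] mult_right_mono[of L "\<bar>L\<bar>" "norm x"] by auto
      then have *: "norm x * norm x \<le> 2 * \<bar>r0\<bar> + 2 * \<bar>L\<bar> * norm x"
        by (simp add: half_sq_norm_def power2_eq_square)
      have nx: "norm x \<le> B"
      proof (rule ccontr)
        assume gt: "\<not> norm x \<le> B"
        then have "1 \<le> norm x" by (simp add: B_def)
        then have "2 * \<bar>r0\<bar> * 1 \<le> 2 * \<bar>r0\<bar> * norm x" by (intro mult_left_mono) auto
        moreover have "B * norm x < norm x * norm x"
          using gt \<open>1 \<le> norm x\<close> by (intro mult_strict_right_mono) auto
        ultimately show False using * \<open>1 \<le> norm x\<close> by (simp add: B_def algebra_simps)
      qed
      then have "(norm x)\<^sup>2 \<le> B\<^sup>2" by (intro power_mono) auto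
      moreover have "0 \<le> B\<^sup>2" by simp
      ultimately have "- B\<^sup>2 \<le> r" using pos unfolding half_sq_norm_def by linarith
      then show ?thesis
        using nx obj half_sq_norm_nonneg[of x] by (simp add: p)
    qed
    moreover have "bounded (cball (0::'a) B \<times> {- B\<^sup>2..r0})" by (intro bounded_Times) auto
    ultimately show ?thesis by (meson bounded_subset subsetI)
  qed
  ultimately have "compact S" by (simp add: compact_eq_bounded_closed)
  moreover have S0: "(0, r0) \<in> S"
    using r0 by (simp add: S_def core_objective_simp half_sq_norm_def)
  ultimately obtain p where p: "p \<in> S" "\<forall>q\<in>S. core_objective p \<le> core_objective q"
    using continuous_attains_inf[OF _ _ cont_obj, of S] by blast
  have "core_objective p \<le> core_objective q" if "q \<in> smoothing_core \<sigma>" for q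
  proof (cases "core_objective q \<le> r0")
    case True
    with that p(2) show ?thesis by (simp only: S_def mem_Collect_eq Ball_def)
  next
    case False
    with p(1) show ?thesis by (simp add: S_def)
  qed
  with p(1) show ?thesis by (intro that[of p]) (auto simp: is_arg_min_def S_def not_less)
qed

lemma core_midpoint:
  assumes sl: "sublinear \<sigma>" and "(x, r) \<in> smoothing_core \<sigma>" "(y, s) \<in> smoothing_core \<sigma>"
  shows "((x + y) /\<^sub>R 2, (r + s) / 2) \<in> smoothing_core \<sigma>"
  unfolding mem_core_iff
proof
  fix z
  have "2 * \<sigma> ((x + y) /\<^sub>R 2 + z) = \<sigma> ((x + z) + (y + z))"
    using sublinear_scale[OF sl, of 2 "(x + y) /\<^sub>R 2 + z"]
    by (simp add: scaleR_add_right scaleR_2 algebra_simps)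
  also have "\<dots> \<le> \<sigma> (x + z) + \<sigma> (y + z)" by (rule sublinear_add[OF sl])
  also have "\<dots> \<le> (r + half_sq_norm z) + (s + half_sq_norm z)"
    using assms(2,3) by (intro add_mono) (auto simp: mem_core_iff)
  finally show "\<sigma> ((x + y) /\<^sub>R 2 + z) \<le> (r + s) / 2 + half_sq_norm z" by argo
qed

lemma half_sq_norm_midpoint:
  "half_sq_norm ((x + y) /\<^sub>R 2) = (half_sq_norm x + half_sq_norm y) / 2 - half_sq_norm (x - y) / 4"
  for x y :: "'a::euclidean_space"
  by (simp add: half_sq_norm_eq_inner inner_add_left inner_add_right inner_diff_left
      inner_diff_right inner_commute field_simps)

text \<open>The core is convex and the objective is strictly convex in \<open>x\<close>: the midpoint of two
  minimizers with different \<open>x\<close> would have a smaller value.\<close>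

lemma core_minimizer_unique:
  fixes \<sigma> :: "'a::euclidean_space \<Rightarrow> real"
  assumes sl: "sublinear \<sigma>"
    and p: "is_arg_min core_objective (\<lambda>q. q \<in> smoothing_core \<sigma>) p"
    and q: "is_arg_min core_objective (\<lambda>q. q \<in> smoothing_core \<sigma>) q"
  shows "p = q"
proof -
  obtain x r y s where xy: "p = (x, r)" "q = (y, s)" by (cases p, cases q)
  have mem: "(x, r) \<in> smoothing_core \<sigma>" "(y, s) \<in> smoothing_core \<sigma>"
    using p q by (auto simp: is_arg_min_def xy)
  have eq: "r + half_sq_norm x = s + half_sq_norm y"
    using p q mem by (force simp: is_arg_min_def xy core_objective_simp not_less)
  have "r + half_sq_norm x \<le> (r + s) / 2 + half_sq_norm ((x + y) /\<^sub>R 2)"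
    using p core_midpoint[OF sl mem] by (force simp: is_arg_min_def xy core_objective_simp not_less)
  then have "half_sq_norm (x - y) \<le> 0" using eq unfolding half_sq_norm_midpoint by argo
  then have "x = y" by (simp add: half_sq_norm_def)
  with eq xy show ?thesis by simp
qed

lemma core_center_is_arg_min:
  fixes \<sigma> :: "'a::euclidean_space \<Rightarrow> real"
  assumes "sublinear \<sigma>"
  shows "is_arg_min core_objective (\<lambda>q. q \<in> smoothing_core \<sigma>) (core_center \<sigma>)"
  unfolding core_center_def
  by (rule theI') (metis core_minimizer_exists[OF assms] core_minimizer_unique[OF assms])

lemma core_center_mem:
  fixes \<sigma> :: "'a::euclidean_space \<Rightarrow> real"
  assumes "sublinear \<sigma>"
  shows "(x_center \<sigma>, r_center \<sigma>) \<in> smoothing_core \<sigma>"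
  using core_center_is_arg_min[OF assms] by (simp add: is_arg_min_def x_center_def r_center_def)

lemma width_le:
  fixes \<sigma> :: "'a::euclidean_space \<Rightarrow> real"
  assumes "sublinear \<sigma>" "(x, r) \<in> smoothing_core \<sigma>"
  shows "width \<sigma> \<le> r + half_sq_norm x"
  using core_center_is_arg_min[OF assms(1)] assms(2)
  by (force simp: is_arg_min_def width_def x_center_def r_center_def core_objective_def not_less)

lemma width_attained_only_at_center:
  fixes \<sigma> :: "'a::euclidean_space \<Rightarrow> real"
  assumes "sublinear \<sigma>" "(x, r) \<in> smoothing_core \<sigma>" "r + half_sq_norm x \<le> width \<sigma>"
  shows "x = x_center \<sigma>"
proof -
  have "is_arg_min core_objective (\<lambda>q. q \<in> smoothing_core \<sigma>) (x, r)"
    using width_le[OF assms(1)] assms(2,3)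
    by (fastforce simp: is_arg_min_def core_objective_simp)
  then have "(x, r) = core_center \<sigma>"
    using core_minimizer_unique core_center_is_arg_min assms(1) by blast
  then show ?thesis unfolding x_center_def by (metis fst_conv)
qed

text \<open>The core is the epigraph of \<open>varrho \<sigma>\<close> because \<open>\<sigma> (x + y)\<close> is the maximum of
  \<open>\<zeta> \<bullet> (x + y)\<close> over the subgradients \<open>\<zeta>\<close>, and \<open>\<zeta> \<bullet> y - |y|\<^sup>2 / 2\<close> is largest at \<open>y = \<zeta>\<close>, with
  value \<open>|\<zeta>|\<^sup>2 / 2\<close>.\<close>

lemma varrho_le_iff_core:
  fixes \<sigma> :: "'a::euclidean_space \<Rightarrow> real"
  assumes sl: "sublinear \<sigma>"
  shows "varrho \<sigma> x \<le> r \<longleftrightarrow> (x, r) \<in> smoothing_core \<sigma>"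
proof -
  let ?K = "subdifferential \<sigma> 0"
  let ?h = "\<lambda>\<zeta>. \<zeta> \<bullet> x + half_sq_norm \<zeta>"
  have le: "?h \<zeta> \<le> s" if "(x, s) \<in> smoothing_core \<sigma>" "\<zeta> \<in> ?K" for s \<zeta>
  proof -
    have "\<zeta> \<bullet> (x + \<zeta>) \<le> \<sigma> (x + \<zeta>)" using that(2) mem_subdifferential_sublinear[OF sl] by blast
    also have "\<dots> \<le> s + half_sq_norm \<zeta>" using that(1) by (simp add: mem_core_iff)
    finally show ?thesis by (simp add: half_sq_norm_eq_inner inner_add_right)
  qed
  have nonempty: "?K \<noteq> {}" by (rule subdifferential_nonempty[OF sl])
  obtain s where "(x, s) \<in> smoothing_core \<sigma>" using core_section_nonempty[OF sl] .
  then have bdd: "bdd_above (?h ` ?K)" using le by (intro bdd_aboveI[of _ s]) auto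
  show ?thesis
  proof
    assume le: "varrho \<sigma> x \<le> r"
    show "(x, r) \<in> smoothing_core \<sigma>"
      unfolding mem_core_iff
    proof
      fix y
      obtain \<zeta> where \<zeta>: "\<zeta> \<in> ?K" "\<zeta> \<bullet> (x + y) = \<sigma> (x + y)" using sublinear_support[OF sl] .
      have "?h \<zeta> \<le> r" using cSUP_upper[OF \<zeta>(1) bdd] le by (simp add: varrho_def)
      then show "\<sigma> (x + y) \<le> r + half_sq_norm y"
        using \<zeta>(2) inner_le_half_sq_norms[of \<zeta> y] by (simp add: inner_add_right)
    qed
  next
    assume "(x, r) \<in> smoothing_core \<sigma>"
    then show "varrho \<sigma> x \<le> r"
      unfolding varrho_def by (intro cSUP_least nonempty le)
  qed
qed

section \<open>The extremal smoothings\<close>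

lemma inf_conv_le:
  assumes "\<And>y. m \<le> f y + g (x - y)"
  shows "inf_conv f g x \<le> f y + g (x - y)"
  unfolding inf_conv_def using assms by (intro cINF_lower bdd_belowI[of _ m]) auto

lemma inf_conv_ge:
  assumes "\<And>y. m \<le> f y + g (x - y)"
  shows "m \<le> inf_conv f g x"
  unfolding inf_conv_def using assms by (intro cINF_greatest) auto

text \<open>The next two lemmas bound the functions minimized in \<open>F_gen\<close> and \<open>f_gen\<close> from below. They
  make the real infima genuine and give the lower distance estimates.\<close>

lemma sublinear_le_F_gen_integrand:
  fixes \<sigma> :: "'a::euclidean_space \<Rightarrow> real"
  assumes "sublinear \<sigma>"
  shows "\<sigma> x \<le> varrho \<sigma> y + half_sq_norm (x - y)"
proof -
  have "\<forall>v. \<sigma> (y + v) \<le> varrho \<sigma> y + half_sq_norm v"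
    using varrho_le_iff_core[OF assms, of y "varrho \<sigma> y"] by (simp add: mem_core_iff)
  from this[rule_format, of "x - y"] show ?thesis by simp
qed

lemma sublinear_le_f_gen_integrand:
  fixes \<sigma> :: "'a::euclidean_space \<Rightarrow> real"
  assumes sl: "sublinear \<sigma>"
  shows "\<sigma> x \<le> r_center \<sigma> + \<sigma> (y - x_center \<sigma>) + half_sq_norm (x - y)"
proof -
  have "\<sigma> x \<le> \<sigma> (x_center \<sigma> + (x - y)) + \<sigma> (y - x_center \<sigma>)"
    using sublinear_add[OF sl, of "x_center \<sigma> + (x - y)" "y - x_center \<sigma>"] by simp
  then show ?thesis
    using core_center_mem[OF sl, unfolded mem_core_iff, rule_format, of "x - y"] by linarith
qed

lemma F_gen_le:
  fixes \<sigma> :: "'a::euclidean_space \<Rightarrow> real"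
  assumes "sublinear \<sigma>"
  shows "F_gen \<sigma> x \<le> varrho \<sigma> y + half_sq_norm (x - y) - width \<sigma> / 2"
  using inf_conv_le[of "\<sigma> x" "varrho \<sigma>" half_sq_norm x y] sublinear_le_F_gen_integrand[OF assms]
  by (simp add: F_gen_def)

lemma F_gen_ge:
  fixes \<sigma> :: "'a::euclidean_space \<Rightarrow> real"
  assumes "sublinear \<sigma>"
  shows "\<sigma> x - width \<sigma> / 2 \<le> F_gen \<sigma> x"
  using inf_conv_ge[of "\<sigma> x" "varrho \<sigma>" half_sq_norm x] sublinear_le_F_gen_integrand[OF assms]
  by (simp add: F_gen_def)

lemma f_gen_le:
  fixes \<sigma> :: "'a::euclidean_space \<Rightarrow> real"
  assumes "sublinear \<sigma>"
  shows "f_gen \<sigma> x \<le> r_center \<sigma> + \<sigma> (y - x_center \<sigma>) + half_sq_norm (x - y) - width \<sigma> / 2"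
  using inf_conv_le[of "\<sigma> x" "\<lambda>y. r_center \<sigma> + \<sigma> (y - x_center \<sigma>)" half_sq_norm x y]
    sublinear_le_f_gen_integrand[OF assms]
  by (simp add: f_gen_def)

lemma f_gen_ge:
  assumes "\<And>y. m \<le> r_center \<sigma> + \<sigma> (y - x_center \<sigma>) + half_sq_norm (x - y) - width \<sigma> / 2"
  shows "m \<le> f_gen \<sigma> x"
proof -
  have "m + width \<sigma> / 2 \<le> inf_conv (\<lambda>y. r_center \<sigma> + \<sigma> (y - x_center \<sigma>)) half_sq_norm x"
    using assms by (intro inf_conv_ge) (simp add: le_diff_eq)
  then show ?thesis by (simp add: f_gen_def)
qed

lemma f_gen_within_width:
  fixes \<sigma> :: "'a::euclidean_space \<Rightarrow> real"
  assumes sl: "sublinear \<sigma>"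
  shows "\<sigma> x - width \<sigma> / 2 \<le> f_gen \<sigma> x" "f_gen \<sigma> x \<le> \<sigma> x + width \<sigma> / 2"
proof -
  show "\<sigma> x - width \<sigma> / 2 \<le> f_gen \<sigma> x"
    using sublinear_le_f_gen_integrand[OF sl, of x] by (intro f_gen_ge diff_right_mono)
  show "f_gen \<sigma> x \<le> \<sigma> x + width \<sigma> / 2"
    using f_gen_le[OF sl, of x "x + x_center \<sigma>"]
    by (simp add: width_def half_sq_norm_minus field_simps)
qed

text \<open>Let \<open>v = x - x_center \<sigma>\<close> and let \<open>p\<close> be its projection onto the subdifferential. The
  infimum that defines \<open>f_gen \<sigma> x\<close> is attained at \<open>y = x - p\<close>, since Moreau's decomposition splits
  \<open>v\<close> into \<open>p\<close> and a vector on which the functional \<open>p\<close> attains \<open>\<sigma>\<close>. Replacing \<open>\<sigma>\<close> by its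
  minorant \<open>p\<close> gives an affine minorant of \<open>f_gen \<sigma>\<close>; keeping the candidate \<open>x - p\<close> fixed while
  the argument moves gives a quadratic majorant. Both touch \<open>f_gen \<sigma>\<close> at \<open>x\<close>.\<close>

lemma f_gen_subgradient_and_upper_model:
  fixes \<sigma> :: "'a::euclidean_space \<Rightarrow> real"
  assumes sl: "sublinear \<sigma>"
  defines "P \<equiv> \<lambda>x. closest_point (subdifferential \<sigma> 0) (x - x_center \<sigma>)"
  shows "f_gen \<sigma> x + P x \<bullet> (y - x) \<le> f_gen \<sigma> y"
    and "f_gen \<sigma> y \<le> f_gen \<sigma> x + P x \<bullet> (y - x) + half_sq_norm (y - x)"
proof -
  let ?K = "subdifferential \<sigma> 0"
  define v where "v = x - x_center \<sigma>"
  define p where "p = P x"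
  define m where "m = r_center \<sigma> - width \<sigma> / 2 + p \<bullet> v - half_sq_norm p"
  have nonempty: "?K \<noteq> {}" by (rule subdifferential_nonempty[OF sl])
  have pK: "p \<bullet> y \<le> \<sigma> y" for y
    using closest_point_in_set[OF closed_convex_subdifferential(1) nonempty] mem_subdifferential_sublinear[OF sl]
    unfolding p_def P_def by blast
  \<comment> \<open>The residual \<open>v - p\<close> lies in the normal cone of \<open>?K\<close> at \<open>p\<close>, so \<open>p\<close> is a maximizing
    functional for it.\<close>
  have res: "\<sigma> (v - p) = p \<bullet> (v - p)"
  proof (rule antisym)
    obtain \<zeta> where \<zeta>: "\<zeta> \<in> ?K" "\<zeta> \<bullet> (v - p) = \<sigma> (v - p)" using sublinear_support[OF sl] .
    have "(v - p) \<bullet> (\<zeta> - p) \<le> 0"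
      unfolding p_def P_def v_def using closest_point_dot[OF closed_convex_subdifferential(2,1) \<zeta>(1)] .
    then show "\<sigma> (v - p) \<le> p \<bullet> (v - p)"
      using \<zeta>(2) by (simp add: inner_diff_right inner_commute)
  qed (rule pK)
  have lower: "m + p \<bullet> (z - x) \<le> f_gen \<sigma> z" for z
  proof (rule f_gen_ge)
    fix y
    have "p \<bullet> (z - y) \<le> half_sq_norm p + half_sq_norm (z - y)" by (rule inner_le_half_sq_norms)
    with pK[of "y - x_center \<sigma>"]
    show "m + p \<bullet> (z - x) \<le> r_center \<sigma> + \<sigma> (y - x_center \<sigma>) + half_sq_norm (z - y) - width \<sigma> / 2"
      by (simp add: m_def v_def inner_diff_right)
  qed
  have upper: "f_gen \<sigma> z \<le> m + p \<bullet> (z - x) + half_sq_norm (z - x)" for z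
  proof -
    have "f_gen \<sigma> z \<le> r_center \<sigma> + \<sigma> (v - p) + half_sq_norm ((z - x) + p) - width \<sigma> / 2"
      using f_gen_le[OF sl, of z "x - p"] by (simp add: v_def algebra_simps)
    also have "\<dots> = m + p \<bullet> (z - x) + half_sq_norm (z - x)"
      unfolding res m_def
      by (simp add: half_sq_norm_eq_inner inner_diff_left inner_diff_right inner_add_left
          inner_add_right inner_commute field_simps)
    finally show ?thesis .
  qed
  have "f_gen \<sigma> x = m" using lower[of x] upper[of x] by (simp add: half_sq_norm_def)
  then show "f_gen \<sigma> x + P x \<bullet> (y - x) \<le> f_gen \<sigma> y"
    and "f_gen \<sigma> y \<le> f_gen \<sigma> x + P x \<bullet> (y - x) + half_sq_norm (y - x)"
    using lower[of y] upper[of y] by (simp_all add: p_def)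
qed

text \<open>The gradient is a translated projection onto a convex set, hence nonexpansive.\<close>

lemma f_gen_smooth_convex:
  fixes \<sigma> :: "'a::euclidean_space \<Rightarrow> real"
  assumes sl: "sublinear \<sigma>"
  shows "smooth_fun 1 (f_gen \<sigma>)" "convex_on UNIV (f_gen \<sigma>)"
proof -
  let ?K = "subdifferential \<sigma> 0"
  let ?P = "\<lambda>x. closest_point ?K (x - x_center \<sigma>)"
  note bounds = f_gen_subgradient_and_upper_model[OF sl]
  have "GDERIV (f_gen \<sigma>) x :> ?P x" for x
    by (rule GDERIV_if_quadratic_sandwich[where L = 1]) (use bounds in simp_all)
  moreover have "norm (?P x - ?P y) \<le> 1 * norm (x - y)" for x y
    using closest_point_lipschitz[of ?K "x - x_center \<sigma>" "y - x_center \<sigma>"]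
      closed_convex_subdifferential[of \<sigma> 0] subdifferential_nonempty[OF sl]
    by (simp add: dist_norm)
  ultimately show "smooth_fun 1 (f_gen \<sigma>)"
    unfolding smooth_fun_def by (intro exI[of _ ?P]) auto
  have "?P x \<in> subdifferential (f_gen \<sigma>) x" for x
    unfolding subdifferential_def[of "f_gen \<sigma>"] using bounds(1) by simp
  then show "convex_on UNIV (f_gen \<sigma>)" by (rule convex_on_if_subgradients)
qed

section \<open>Smoothings of unit smoothness\<close>

text \<open>The core point is the vertex of the paraboloid that the descent lemma places above \<open>f\<close> at
  \<open>z\<close>, raised by \<open>d\<close>.\<close>

lemma core_point_of_smooth_fun:
  fixes \<sigma> :: "'a::euclidean_space \<Rightarrow> real"
  assumes grad: "\<And>x. GDERIV f x :> g x"
    and lip: "\<And>x y. norm (g x - g y) \<le> norm (x - y)"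
    and near: "\<And>y. \<sigma> y \<le> f y + d"
  shows "(z - g z, d + f z - half_sq_norm (g z)) \<in> smoothing_core \<sigma>"
  unfolding mem_core_iff
proof
  fix y
  have "\<sigma> (z - g z + y) \<le> f (z - g z + y) + d" by (rule near)
  also have "f (z - g z + y) \<le> f z + g z \<bullet> (y - g z) + half_sq_norm (y - g z)"
    using descent_lemma[OF grad, of 1 "z - g z + y" z] lip by simp
  finally show "\<sigma> (z - g z + y) \<le> d + f z - half_sq_norm (g z) + half_sq_norm y"
    by (simp add: half_sq_norm_eq_inner inner_diff_left inner_diff_right inner_commute field_simps)
qed

text \<open>At \<open>z = 0\<close> the terms in \<open>g 0\<close> cancel from the objective of the core point, which leaves
  \<open>d + f 0\<close>, and \<open>f 0 \<le> d\<close> because \<open>\<sigma> 0 = 0\<close>.\<close>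

lemma width_half_le_fun_dist:
  fixes \<sigma> :: "'a::euclidean_space \<Rightarrow> real"
  assumes sl: "sublinear \<sigma>" and sm: "smooth_fun 1 f" and d: "fun_dist f \<sigma> \<le> ereal d"
  shows "width \<sigma> / 2 \<le> d"
proof -
  obtain g where grad: "\<And>x. GDERIV f x :> g x" and lip: "\<And>x y. norm (g x - g y) \<le> norm (x - y)"
    using sm by (auto simp: smooth_fun_def)
  have near: "\<And>y. \<sigma> y \<le> f y + d" "\<And>y. f y \<le> \<sigma> y + d"
    using d by (auto simp: fun_dist_le_iff_two_sided)
  have "(0 - g 0, d + f 0 - half_sq_norm (g 0)) \<in> smoothing_core \<sigma>"
    by (rule core_point_of_smooth_fun[OF grad lip near(1)])
  from width_le[OF sl this] near(2)[of 0] show ?thesis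
    by (simp add: half_sq_norm_minus sublinear_zero[OF sl])
qed

text \<open>For a function at distance half the width, smoothness gives \<open>F_gen \<sigma> \<le> f\<close>. The bound \<open>f \<le> f_gen \<sigma>\<close> combines convexity with
  the fact that the value and gradient of \<open>f\<close> at \<open>0\<close> are forced by the center.\<close>

lemma gen_bounds_iff_optimal_distance:
  fixes \<sigma> :: "'a::euclidean_space \<Rightarrow> real"
  assumes sl: "sublinear \<sigma>" and sm: "smooth_fun 1 f" and conv: "convex_on UNIV f"
  shows "fun_dist f \<sigma> \<le> ereal (width \<sigma> / 2) \<longleftrightarrow> (\<forall>x. F_gen \<sigma> x \<le> f x \<and> f x \<le> f_gen \<sigma> x)"
proof
  assume "\<forall>x. F_gen \<sigma> x \<le> f x \<and> f x \<le> f_gen \<sigma> x"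
  then have "\<sigma> x \<le> f x + width \<sigma> / 2" "f x \<le> \<sigma> x + width \<sigma> / 2" for x
    using F_gen_ge[OF sl, of x] f_gen_within_width(2)[OF sl, of x]
    by (meson diff_le_eq order_trans)+
  then show "fun_dist f \<sigma> \<le> ereal (width \<sigma> / 2)"
    unfolding fun_dist_le_iff_two_sided by blast
next
  assume "fun_dist f \<sigma> \<le> ereal (width \<sigma> / 2)"
  then have near: "\<And>y. \<sigma> y \<le> f y + width \<sigma> / 2" "\<And>y. f y \<le> \<sigma> y + width \<sigma> / 2"
    by (auto simp: fun_dist_le_iff_two_sided)
  obtain g where grad: "\<And>x. GDERIV f x :> g x" and lip: "\<And>x y. norm (g x - g y) \<le> norm (x - y)"
    using sm by (auto simp: smooth_fun_def)
  have core: "(z - g z, width \<sigma> / 2 + f z - half_sq_norm (g z)) \<in> smoothing_core \<sigma>" for z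
    by (rule core_point_of_smooth_fun[OF grad lip near(1)])
  have f0: "f 0 \<le> width \<sigma> / 2" using near(2)[of 0] by (simp add: sublinear_zero[OF sl])
  \<comment> \<open>The core point at \<open>0\<close> has the minimal objective value, hence is the center.\<close>
  have "0 - g 0 = x_center \<sigma>"
    using f0 by (intro width_attained_only_at_center[OF sl core]) (simp add: half_sq_norm_minus)
  then have g0: "g 0 = - x_center \<sigma>" by (simp add: equation_minus_iff)
  show "\<forall>x. F_gen \<sigma> x \<le> f x \<and> f x \<le> f_gen \<sigma> x"
  proof (intro allI conjI)
    fix z
    have "varrho \<sigma> (z - g z) \<le> width \<sigma> / 2 + f z - half_sq_norm (g z)"
      using core varrho_le_iff_core[OF sl] by blast
    then show "F_gen \<sigma> z \<le> f z" using F_gen_le[OF sl, of z "z - g z"] by simp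
    have "g z \<in> subdifferential \<sigma> 0"
      by (rule subgradient_of_function_near_sublinear[OF sl
            gradient_in_subdifferential[OF conv grad] near(2)])
    then have gK: "g z \<bullet> y \<le> \<sigma> y" for y using mem_subdifferential_sublinear[OF sl] by blast
    have coco: "f z - g z \<bullet> z + half_sq_norm (g z + x_center \<sigma>) \<le> width \<sigma> / 2"
      using smooth_convex_lower_bound[OF conv grad, of 1 z 0] lip f0 by (simp add: g0)
    show "f z \<le> f_gen \<sigma> z"
    proof (rule f_gen_ge)
      fix y
      have "g z \<bullet> (z - y) \<le> half_sq_norm (g z) + half_sq_norm (z - y)"
        by (rule inner_le_half_sq_norms)
      moreover have "half_sq_norm (g z + x_center \<sigma>)
          = half_sq_norm (g z) + g z \<bullet> x_center \<sigma> + half_sq_norm (x_center \<sigma>)"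
        by (simp add: half_sq_norm_eq_inner inner_add_left inner_add_right inner_commute field_simps)
      ultimately show "f z \<le> r_center \<sigma> + \<sigma> (y - x_center \<sigma>) + half_sq_norm (z - y) - width \<sigma> / 2"
        using coco gK[of "y - x_center \<sigma>"] unfolding width_def inner_diff_right by argo
    qed
  qed
qed

section \<open>Arbitrary smoothness levels\<close>

lemma smooth_convex_at_width_exists:
  fixes \<sigma> :: "'a::euclidean_space \<Rightarrow> real"
  assumes sl: "sublinear \<sigma>" and "0 < \<beta>"
  obtains h where "convex_on UNIV h" "smooth_fun \<beta> h" "fun_dist h \<sigma> \<le> ereal (width \<sigma> / 2 / \<beta>)"
proof
  let ?h = "rescale (1 / \<beta>) (f_gen \<sigma>)"
  show "convex_on UNIV ?h" using f_gen_smooth_convex[OF sl] assms(2) by (intro convex_on_rescale) auto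
  show "smooth_fun \<beta> ?h"
    using smooth_fun_rescale[OF f_gen_smooth_convex(1)[OF sl], of "1 / \<beta>"] assms(2) by simp
  have "fun_dist (f_gen \<sigma>) \<sigma> \<le> ereal (width \<sigma> / 2)"
    unfolding fun_dist_le_iff_two_sided using f_gen_within_width[OF sl]
    by (simp add: diff_le_eq)
  from fun_dist_rescale_le[OF sl _ this, of "1 / \<beta>"] assms(2)
  show "fun_dist ?h \<sigma> \<le> ereal (width \<sigma> / 2 / \<beta>)" by (simp add: mult.commute)
qed

lemma width_le_fun_dist:
  fixes \<sigma> :: "'a::euclidean_space \<Rightarrow> real"
  assumes sl: "sublinear \<sigma>" and "0 < \<beta>" and sm: "smooth_fun \<beta> f"
  shows "ereal (width \<sigma> / 2 / \<beta>) \<le> fun_dist f \<sigma>"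
proof (rule ereal_le_real)
  fix d assume "fun_dist f \<sigma> \<le> ereal d"
  then have "fun_dist (rescale \<beta> f) \<sigma> \<le> ereal (\<beta> * d)" by (rule fun_dist_rescale_le[OF sl assms(2)])
  moreover have "smooth_fun 1 (rescale \<beta> f)"
    using smooth_fun_rescale[OF sm assms(2)] assms(2) by simp
  ultimately have "width \<sigma> / 2 \<le> \<beta> * d" by (intro width_half_le_fun_dist[OF sl])
  then show "ereal (width \<sigma> / 2 / \<beta>) \<le> ereal d"
    using assms(2) by (simp add: field_simps)
qed

lemma optimal_smoothing_iff_distance:
  fixes \<sigma> :: "'a::euclidean_space \<Rightarrow> real"
  assumes sl: "sublinear \<sigma>" and "0 < \<beta>" and "smooth_fun \<beta> f" "convex_on UNIV f"
  shows "optimal_smoothing \<beta> \<sigma> f \<longleftrightarrow> fun_dist f \<sigma> \<le> ereal (width \<sigma> / 2 / \<beta>)"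
proof
  assume "optimal_smoothing \<beta> \<sigma> f"
  moreover obtain h where "convex_on UNIV h" "smooth_fun \<beta> h"
    "fun_dist h \<sigma> \<le> ereal (width \<sigma> / 2 / \<beta>)"
    using smooth_convex_at_width_exists[OF sl assms(2)] .
  ultimately show "fun_dist f \<sigma> \<le> ereal (width \<sigma> / 2 / \<beta>)"
    unfolding optimal_smoothing_def fun_dist_commute[of \<sigma>] by (meson order_trans)
next
  assume "fun_dist f \<sigma> \<le> ereal (width \<sigma> / 2 / \<beta>)"
  then show "optimal_smoothing \<beta> \<sigma> f"
    unfolding optimal_smoothing_def fun_dist_commute[of \<sigma>]
    using assms width_le_fun_dist[OF sl assms(2)] by (meson order_trans)
qed

lemma fun_dist_rescale_le_iff:
  assumes "sublinear \<sigma>" "0 < \<eta>"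
  shows "fun_dist (rescale \<eta> f) \<sigma> \<le> ereal d \<longleftrightarrow> fun_dist f \<sigma> \<le> ereal (d / \<eta>)"
proof
  assume "fun_dist (rescale \<eta> f) \<sigma> \<le> ereal d"
  from fun_dist_rescale_le[OF assms(1) _ this, of "1 / \<eta>"] assms(2)
  show "fun_dist f \<sigma> \<le> ereal (d / \<eta>)" by (simp add: rescale_rescale_inverse)
next
  assume "fun_dist f \<sigma> \<le> ereal (d / \<eta>)"
  from fun_dist_rescale_le[OF assms this] assms(2)
  show "fun_dist (rescale \<eta> f) \<sigma> \<le> ereal d" by simp
qed

lemma rescale_le_swap:
  assumes "0 < \<beta>"
  shows "(\<forall>x. F x \<le> rescale \<beta> f x) \<longleftrightarrow> (\<forall>x. rescale (1 / \<beta>) F x \<le> f x)"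
    and "(\<forall>x. rescale \<beta> f x \<le> F x) \<longleftrightarrow> (\<forall>x. f x \<le> rescale (1 / \<beta>) F x)"
proof -
  have inv: "rescale (1 / \<beta>) (rescale \<beta> f) = f" "rescale \<beta> (rescale (1 / \<beta>) F) = F"
    using assms rescale_rescale_inverse[of \<beta> f] rescale_rescale_inverse[of "1 / \<beta>" F] by auto
  show "(\<forall>x. F x \<le> rescale \<beta> f x) \<longleftrightarrow> (\<forall>x. rescale (1 / \<beta>) F x \<le> f x)"
    using rescale_mono[of "1 / \<beta>" F "rescale \<beta> f"] rescale_mono[of \<beta> "rescale (1 / \<beta>) F" f]
      assms by (auto simp: inv)
  show "(\<forall>x. rescale \<beta> f x \<le> F x) \<longleftrightarrow> (\<forall>x. f x \<le> rescale (1 / \<beta>) F x)"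
    using rescale_mono[of "1 / \<beta>" "rescale \<beta> f" F] rescale_mono[of \<beta> f "rescale (1 / \<beta>) F"]
      assms by (auto simp: inv)
qed

theorem theorem4p1:
  fixes \<sigma> :: "'a::euclidean_space \<Rightarrow> real"
  assumes "sublinear \<sigma>"
  shows "(\<forall>l::real. smoothable l \<sigma> \<longleftrightarrow> l \<ge> width \<sigma> / 2) \<and>
    (\<forall>\<beta>>0. \<forall>f::'a \<Rightarrow> real. smooth_fun \<beta> f \<and> convex_on UNIV f \<longrightarrow>
       (optimal_smoothing \<beta> \<sigma> f \<longleftrightarrow>
        (\<forall>x. rescale (1 / \<beta>) (F_gen \<sigma>) x \<le> f x \<and> f x \<le> rescale (1 / \<beta>) (f_gen \<sigma>) x)))"
proof (intro conjI allI impI)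
  fix l
  show "smoothable l \<sigma> \<longleftrightarrow> width \<sigma> / 2 \<le> l"
  proof
    assume "smoothable l \<sigma>"
    then obtain f where "smooth_fun 1 f" "fun_dist f \<sigma> \<le> ereal (l / 1)"
      unfolding smoothable_def using zero_less_one by blast
    then show "width \<sigma> / 2 \<le> l" using width_half_le_fun_dist[OF assms, of f l] by simp
  next
    assume l: "width \<sigma> / 2 \<le> l"
    show "smoothable l \<sigma>"
      unfolding smoothable_def
    proof (intro allI impI)
      fix \<beta> :: real assume "0 < \<beta>"
      moreover from this have "ereal (width \<sigma> / 2 / \<beta>) \<le> ereal (l / \<beta>)"
        using l by (simp add: divide_right_mono del: divide_divide_eq_left)
      ultimately show "\<exists>f. convex_on UNIV f \<and> smooth_fun \<beta> f \<and> fun_dist f \<sigma> \<le> ereal (l / \<beta>)"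
        by (meson smooth_convex_at_width_exists[OF assms] order_trans)
    qed
  qed
next
  fix \<beta> :: real and f :: "'a \<Rightarrow> real"
  assume \<beta>: "0 < \<beta>" and f: "smooth_fun \<beta> f \<and> convex_on UNIV f"
  have unit: "smooth_fun 1 (rescale \<beta> f)" "convex_on UNIV (rescale \<beta> f)"
    using f \<beta> smooth_fun_rescale[of \<beta> f \<beta>] convex_on_rescale[of f \<beta>] by auto
  have "optimal_smoothing \<beta> \<sigma> f \<longleftrightarrow> fun_dist f \<sigma> \<le> ereal (width \<sigma> / 2 / \<beta>)"
    using optimal_smoothing_iff_distance[OF assms \<beta>] f by blast
  also have "\<dots> \<longleftrightarrow> fun_dist (rescale \<beta> f) \<sigma> \<le> ereal (width \<sigma> / 2)"
    using fun_dist_rescale_le_iff[OF assms \<beta>] by blast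
  also have "\<dots> \<longleftrightarrow> (\<forall>x. F_gen \<sigma> x \<le> rescale \<beta> f x) \<and> (\<forall>x. rescale \<beta> f x \<le> f_gen \<sigma> x)"
    using gen_bounds_iff_optimal_distance[OF assms unit] by blast
  also have "\<dots> \<longleftrightarrow> (\<forall>x. rescale (1 / \<beta>) (F_gen \<sigma>) x \<le> f x \<and> f x \<le> rescale (1 / \<beta>) (f_gen \<sigma>) x)"
    unfolding rescale_le_swap[OF \<beta>] by blast
  finally show "optimal_smoothing \<beta> \<sigma> f \<longleftrightarrow>
      (\<forall>x. rescale (1 / \<beta>) (F_gen \<sigma>) x \<le> f x \<and> f x \<le> rescale (1 / \<beta>) (f_gen \<sigma>) x)" .
qed

end
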